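(* Let $K$ be a field, let $n\geq 1$ be an integer, and let $\varphi:\mathrm{M}_{n\times n}(K)\longrightarrow\mathrm{M}_{n\times n}(K)$ be a $K$-automorphism of the full $n\times n$ matrix algebra over $K$. Then there exists an invertible matrix $A\in\mathrm{M}_{n\times n}(K)$ such that $\varphi(X)=AXA^{-1}$ for all $X\in\mathrm{M}_{n\times n}(K)$.
   Context: $\mathrm{M}_{n\times n}(K)$ denotes the $K$-algebra of all $n\times n$ matrices with entries in $K$. A $K$-automorphism is a bijective, $K$-linear, multiplicative, unital map from the algebra to itself. *)

theory Defs
  imports "Jordan_Normal_Form.Matrix"
begin

text \<open>A matrix over a field type \<open>'a\<close> carries its dimensions at run time, so
  the algebra of all square matrices of size \<open>n\<close> is the set \<^term>\<open>carrier_mat n n\<close>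
  and nothing is required of \<open>\<phi>\<close> outside it.\<close>

definition mat_algebra_automorphism :: "nat \<Rightarrow> ('a::field mat \<Rightarrow> 'a mat) \<Rightarrow> bool" where
  "mat_algebra_automorphism n \<phi> \<longleftrightarrow>
     bij_betw \<phi> (carrier_mat n n) (carrier_mat n n) \<and>
     (\<forall>X\<in>carrier_mat n n. \<forall>Y\<in>carrier_mat n n. \<phi> (X + Y) = \<phi> X + \<phi> Y) \<and>
     (\<forall>c. \<forall>X\<in>carrier_mat n n. \<phi> (c \<cdot>\<^sub>m X) = c \<cdot>\<^sub>m \<phi> X) \<and>
     (\<forall>X\<in>carrier_mat n n. \<forall>Y\<in>carrier_mat n n. \<phi> (X * Y) = \<phi> X * \<phi> Y) \<and>
     \<phi> (1\<^sub>m n) = 1\<^sub>m n"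

end

theory Submission
  imports Defs "Jordan_Normal_Form.Determinant"
begin

text \<open>
  Let \<open>E i j\<close> be the matrix units. They satisfy \<open>E 0 i * X * E j 0 = X\<^sub>i\<^sub>j \<cdot> E 0 0\<close>, so an
  algebra endomorphism \<open>\<phi>\<close> gives \<open>\<phi> (E 0 i) * \<phi> X * \<phi> (E j 0) = X\<^sub>i\<^sub>j \<cdot> \<phi> (E 0 0)\<close>. Injectivity
  makes some entry \<open>c = \<phi> (E 0 0)\<^sub>p\<^sub>q\<close> nonzero. Reading the last identity at the entry \<open>(p, q)\<close>
  only involves row \<open>p\<close> of \<open>\<phi> (E 0 i)\<close> and column \<open>q\<close> of \<open>\<phi> (E j 0)\<close>. Collect these rows,
  divided by \<open>c\<close>, into a matrix \<open>B\<close>, and these columns into a matrix \<open>A\<close>: the identity then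
  says \<open>B * \<phi> X * A = X\<close> for every \<open>X\<close>. For \<open>X = 1\<close> it says that \<open>B\<close> is the inverse of \<open>A\<close>,
  and hence \<open>\<phi> X = A * X * B\<close>.
\<close>

definition mat_unit :: "nat \<Rightarrow> nat \<Rightarrow> nat \<Rightarrow> 'a::field mat" where
  "mat_unit n i j = mat n n (\<lambda>(r, s). if r = i \<and> s = j then 1 else 0)"

lemma mat_unit_carrier [simp]: "mat_unit n i j \<in> carrier_mat n n"
  by (simp add: mat_unit_def)

lemma mat_unit_mult_index:
  assumes X: "X \<in> carrier_mat n n" and "i < n" "r < n" "s < n"
  shows "(mat_unit n k i * X) $$ (r, s) = (if r = k then X $$ (i, s) else 0)"
  using assms
  by (simp add: mat_unit_def scalar_prod_def
      if_distrib[of "\<lambda>x. x * _"] if_distrib[of "\<lambda>x. _ * x"] cong: if_cong)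

lemma mult_mat_unit_index:
  assumes X: "X \<in> carrier_mat n n" and "j < n" "r < n" "s < n"
  shows "(X * mat_unit n j k) $$ (r, s) = (if s = k then X $$ (r, j) else 0)"
  using assms
  by (simp add: mat_unit_def scalar_prod_def
      if_distrib[of "\<lambda>x. x * _"] if_distrib[of "\<lambda>x. _ * x"] cong: if_cong)

lemma mat_unit_sandwich:
  assumes X: "X \<in> carrier_mat n n" and "i < n" "j < n"
  shows "mat_unit n k i * (X * mat_unit n j l) = X $$ (i, j) \<cdot>\<^sub>m mat_unit n k l"
proof (rule eq_matI)
  fix r s
  assume "r < dim_row (X $$ (i, j) \<cdot>\<^sub>m mat_unit n k l)"
    and "s < dim_col (X $$ (i, j) \<cdot>\<^sub>m mat_unit n k l)"
  then have "r < n" "s < n" by (simp_all add: mat_unit_def)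
  with assms show "(mat_unit n k i * (X * mat_unit n j l)) $$ (r, s) =
      (X $$ (i, j) \<cdot>\<^sub>m mat_unit n k l) $$ (r, s)"
    by (simp add: mat_unit_mult_index mult_mat_unit_index mult_carrier_mat[of _ n n]
        del: index_mult_mat) (simp add: mat_unit_def)
qed (auto simp: mat_unit_def)

text \<open>Only row \<open>p\<close> of \<open>L\<close> and column \<open>q\<close> of \<open>R\<close> enter the \<open>(p, q)\<close> entry of \<open>L * M * R\<close>. This
  is what allows row \<open>i\<close> of one matrix and column \<open>j\<close> of another to be borrowed from factors
  depending on \<open>i\<close> and \<open>j\<close>.\<close>

lemma mult_mult_index_cong:
  assumes M: "M \<in> carrier_mat n n"
    and L: "L \<in> carrier_mat n n" "L' \<in> carrier_mat n n"
    and R: "R \<in> carrier_mat n n" "R' \<in> carrier_mat n n"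
    and ix: "i < n" "j < n" "p < n" "q < n"
    and row: "\<And>k. k < n \<Longrightarrow> L' $$ (i, k) = d * L $$ (p, k)"
    and col: "\<And>k. k < n \<Longrightarrow> R' $$ (k, j) = R $$ (k, q)"
  shows "(L' * (M * R')) $$ (i, j) = d * (L * (M * R)) $$ (p, q)"
proof -
  have MR: "(M * R') $$ (k, j) = (M * R) $$ (k, q)" if "k < n" for k
    using that M R ix col by (simp add: scalar_prod_def)
  have "(L' * (M * R')) $$ (i, j) = (\<Sum>k\<in>{0..<n}. L' $$ (i, k) * (M * R') $$ (k, j))"
    using M L R ix by (simp add: scalar_prod_def)
  also have "\<dots> = (\<Sum>k\<in>{0..<n}. d * (L $$ (p, k) * (M * R) $$ (k, q)))"
    by (rule sum.cong) (simp_all add: MR row mult.assoc del: index_mult_mat)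
  also have "\<dots> = d * (\<Sum>k\<in>{0..<n}. L $$ (p, k) * (M * R) $$ (k, q))"
    by (simp only: sum_distrib_left)
  also have "(\<Sum>k\<in>{0..<n}. L $$ (p, k) * (M * R) $$ (k, q)) = (L * (M * R)) $$ (p, q)"
    using M L R ix by (simp add: scalar_prod_def)
  finally show ?thesis .
qed

theorem mainTheorem1:
  fixes \<phi> :: "'a::field mat \<Rightarrow> 'a mat" and n :: nat
  assumes "n \<ge> 1"
    and "mat_algebra_automorphism n \<phi>"
  shows "\<exists>A\<in>carrier_mat n n. invertible_mat A \<and>
           (\<exists>B\<in>carrier_mat n n. inverts_mat A B \<and> inverts_mat B A \<and>
              (\<forall>X\<in>carrier_mat n n. \<phi> X = A * X * B))"
proof -
  let ?E = "mat_unit n :: nat \<Rightarrow> nat \<Rightarrow> 'a mat"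
  have inj: "inj_on \<phi> (carrier_mat n n)"
    and \<phi>_carrier: "\<And>X. X \<in> carrier_mat n n \<Longrightarrow> \<phi> X \<in> carrier_mat n n"
    and \<phi>_smult: "\<And>c X. X \<in> carrier_mat n n \<Longrightarrow> \<phi> (c \<cdot>\<^sub>m X) = c \<cdot>\<^sub>m \<phi> X"
    and \<phi>_mult: "\<And>X Y. X \<in> carrier_mat n n \<Longrightarrow> Y \<in> carrier_mat n n \<Longrightarrow>
        \<phi> (X * Y) = \<phi> X * \<phi> Y"
    and \<phi>_one: "\<phi> (1\<^sub>m n) = 1\<^sub>m n"
    using assms(2) by (auto simp: mat_algebra_automorphism_def bij_betw_def)

  have \<phi>E: "\<phi> (?E i j) \<in> carrier_mat n n" for i j
    by (simp add: \<phi>_carrier)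
  have "\<phi> (?E 0 0) \<noteq> 0\<^sub>m n n"
  proof
    assume zero: "\<phi> (?E 0 0) = 0\<^sub>m n n"
    have "\<phi> (0 \<cdot>\<^sub>m ?E 0 0) = \<phi> (?E 0 0)"
      by (subst \<phi>_smult) (auto simp: zero)
    then have "0 \<cdot>\<^sub>m ?E 0 0 = ?E 0 0"
      by (rule inj_onD[OF inj]) auto
    then have "(0 \<cdot>\<^sub>m ?E 0 0) $$ (0, 0) = ?E 0 0 $$ (0, 0)"
      by simp
    then show False using assms(1) by (simp add: mat_unit_def)
  qed
  then obtain p q where pq: "p < n" "q < n" and c0: "\<phi> (?E 0 0) $$ (p, q) \<noteq> 0"
    using \<phi>E[of 0 0] by (metis carrier_matD eq_matI index_zero_mat)
  define c where "c = \<phi> (?E 0 0) $$ (p, q)"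
  define A where "A = mat n n (\<lambda>(i, j). \<phi> (?E j 0) $$ (i, q))"
  define B where "B = mat n n (\<lambda>(i, j). inverse c * \<phi> (?E 0 i) $$ (p, j))"
  have A: "A \<in> carrier_mat n n" and B: "B \<in> carrier_mat n n"
    by (simp_all add: A_def B_def)

  have undo: "B * (\<phi> X * A) = X" if X: "X \<in> carrier_mat n n" for X
  proof (rule eq_matI)
    fix i j assume "i < dim_row X" "j < dim_col X"
    with X have ij: "i < n" "j < n" by auto
    have "(B * (\<phi> X * A)) $$ (i, j) =
        inverse c * (\<phi> (?E 0 i) * (\<phi> X * \<phi> (?E j 0))) $$ (p, q)"
      by (rule mult_mult_index_cong[OF \<phi>_carrier[OF X] \<phi>E B \<phi>E A ij pq])
        (use ij in \<open>simp_all add: A_def B_def\<close>)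
    also have "\<phi> (?E 0 i) * (\<phi> X * \<phi> (?E j 0)) = \<phi> (?E 0 i * (X * ?E j 0))"
      using X by (simp add: \<phi>_mult mult_carrier_mat[of _ n n])
    also have "\<dots> = X $$ (i, j) \<cdot>\<^sub>m \<phi> (?E 0 0)"
      using X ij by (simp add: mat_unit_sandwich \<phi>_smult)
    also have "inverse c * (X $$ (i, j) \<cdot>\<^sub>m \<phi> (?E 0 0)) $$ (p, q) = X $$ (i, j)"
      using c0 pq \<phi>E[of 0 0] by (simp add: c_def)
    finally show "(B * (\<phi> X * A)) $$ (i, j) = X $$ (i, j)" .
  qed (use X A B in auto)

  have BA: "B * A = 1\<^sub>m n"
    using undo[of "1\<^sub>m n"] A by (simp add: \<phi>_one)
  then have AB: "A * B = 1\<^sub>m n"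
    by (rule mat_mult_left_right_inverse[OF B A])
  have conj: "\<phi> X = A * X * B" if X: "X \<in> carrier_mat n n" for X
  proof -
    note C = \<phi>_carrier[OF X]
    have "A * X * B = A * (B * (\<phi> X * A)) * B"
      by (simp only: undo[OF X])
    also have "\<dots> = (A * B) * (\<phi> X * (A * B))"
      using A B C by (simp add: assoc_mult_mat[of _ n n _ n _ n] mult_carrier_mat[of _ n n])
    also have "\<dots> = \<phi> X"
      using C by (simp add: AB)
    finally show ?thesis by simp
  qed
  have inv: "inverts_mat A B" "inverts_mat B A"
    using A B AB BA by (auto simp: inverts_mat_def)
  then have "invertible_mat A"
    using A by (auto simp: invertible_mat_def)
  with A B inv conj show ?thesis by blast
qed

end
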